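(* Let $T$ be a finite tournament with at least one arc, and let $W$ be a tournamenton. If for every arc $a\in A(T)$ the arc-rooted density $r_a^W$ is almost everywhere equal to a constant, then either $t(T,W)=0$ or $W=1/2$ almost everywhere. If $T$ is arc-transitive, the same conclusion (either $t(T,W)=0$ or $W=1/2$ almost everywhere) follows if $r_a^W$ is almost everywhere equal to a constant for a single arc $a\in A(T)$.
   Context: A finite tournament $T=(V,A)$ is an orientation of a complete graph on a finite vertex set; $A(T)$ is its arc set. $T$ is arc-transitive if its automorphism group acts transitively on $A(T)$. A tournamenton is a measurable function $W\colon[0,1]^2\to[0,1]$ with $W(x,y)+W(y,x)=1$ for almost every $(x,y)$. Integrals are with respect to Lebesgue measure. Define $$t(T,W):=\int_{[0,1]^V}\prod_{(s,t)\in A}W(x_s,x_t)\prod_{v\in V}dx_v.$$ For an arc $a=(i,j)\in A$, the arc-rooted density $r_a^W(x,y)$ is the function on $[0,1]^2$ obtained from the same integrand by fixing $x_i=x$, $x_j=y$ and integrating the remaining vertex variables over $[0,1]^{V\setminus\{i,j\}}$ (the factor of $a$ itself is included). *)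

theory Defs
  imports
    "HOL-Analysis.Analysis"
    "Graph_Theory.Pair_Digraph"
    "Graph_Theory.Digraph_Isomorphism"
begin

locale tournament = pair_digraph T for T :: "'a pair_pre_digraph" +
  assumes exactly_one_arc:
    "\<lbrakk>u \<in> pverts T; v \<in> pverts T; u \<noteq> v\<rbrakk> \<Longrightarrow> (u, v) \<in> parcs T \<longleftrightarrow> (v, u) \<notin> parcs T"

definition digraph_automorphism ::
    "('a, 'b) pre_digraph \<Rightarrow> ('a, 'b, 'a, 'b) digraph_isomorphism \<Rightarrow> bool" where
  "digraph_automorphism G h \<longleftrightarrow> pre_digraph.digraph_isomorphism G h \<and> app_iso h G = G"

definition arc_transitive :: "('a, 'b) pre_digraph \<Rightarrow> bool" where
  "arc_transitive G \<longleftrightarrow>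
    (\<forall>a \<in> arcs G. \<forall>b \<in> arcs G. \<exists>h. digraph_automorphism G h \<and> iso_arcs h a = b)"

text \<open>In a digraph without parallel arcs an automorphism is determined by a permutation of the
  vertices that preserves arcs in both directions.\<close>

lemma (in pair_wf_digraph) arc_transitive_iff_vertex_maps:
  "arc_transitive (with_proj G) \<longleftrightarrow>
    (\<forall>a \<in> parcs G. \<forall>b \<in> parcs G. \<exists>\<phi>. bij_betw \<phi> (pverts G) (pverts G) \<and>
      (\<forall>u \<in> pverts G. \<forall>v \<in> pverts G. (\<phi> u, \<phi> v) \<in> parcs G \<longleftrightarrow> (u, v) \<in> parcs G) \<and>
      (\<phi> (fst a), \<phi> (snd a)) = b)" (is "?L \<longleftrightarrow> ?R")
proof
  assume L: ?L
  show ?R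
  proof (intro ballI)
    fix a b assume ab: "a \<in> parcs G" "b \<in> parcs G"
    then obtain h where h: "digraph_automorphism (with_proj G) h" and hab: "iso_arcs h a = b"
      using L unfolding arc_transitive_def by auto
    have iso: "pre_digraph.digraph_isomorphism (with_proj G) h"
      and self: "app_iso h (with_proj G) = with_proj G"
      using h unfolding digraph_automorphism_def by auto
    have V: "iso_verts h ` pverts G = pverts G" and A: "iso_arcs h ` parcs G = parcs G"
      and tl: "iso_tail h = fst" and hd: "iso_head h = snd"
      using self by (simp_all add: app_iso_def with_proj_def)
    have injV: "inj_on (iso_verts h) (pverts G)"
      and ends: "\<And>e. e \<in> parcs G \<Longrightarrow> iso_arcs h e = (iso_verts h (fst e), iso_verts h (snd e))"
      using iso tl hd unfolding pre_digraph.digraph_isomorphism_def by (auto simp: prod_eq_iff)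
    have arcs_iff: "(iso_verts h u, iso_verts h v) \<in> parcs G \<longleftrightarrow> (u, v) \<in> parcs G"
      if uv: "u \<in> pverts G" "v \<in> pverts G" for u v
    proof
      assume "(u, v) \<in> parcs G"
      then show "(iso_verts h u, iso_verts h v) \<in> parcs G"
        using ends[of "(u, v)"] A by force
    next
      assume "(iso_verts h u, iso_verts h v) \<in> parcs G"
      then obtain e where e: "e \<in> parcs G" "iso_arcs h e = (iso_verts h u, iso_verts h v)"
        using A by (metis imageE)
      then have "iso_verts h (fst e) = iso_verts h u" "iso_verts h (snd e) = iso_verts h v"
        using ends by auto
      then have "fst e = u" "snd e = v"
        using injV uv e(1) arc_fst_in_verts arc_snd_in_verts by (auto dest: inj_onD)
      then show "(u, v) \<in> parcs G" using e(1) by auto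
    qed
    show "\<exists>\<phi>. bij_betw \<phi> (pverts G) (pverts G) \<and>
      (\<forall>u \<in> pverts G. \<forall>v \<in> pverts G. (\<phi> u, \<phi> v) \<in> parcs G \<longleftrightarrow> (u, v) \<in> parcs G) \<and>
      (\<phi> (fst a), \<phi> (snd a)) = b"
      using injV V arcs_iff ends[OF ab(1)] hab
      by (intro exI[of _ "iso_verts h"]) (auto simp: bij_betw_def)
  qed
next
  assume R: ?R
  have "\<exists>h. digraph_automorphism (with_proj G) h \<and> iso_arcs h a = b"
    if ab: "a \<in> parcs G" "b \<in> parcs G" for a b
  proof -
    obtain \<phi> where bij: "bij_betw \<phi> (pverts G) (pverts G)"
      and pres: "\<And>u v. u \<in> pverts G \<Longrightarrow> v \<in> pverts G \<Longrightarrow>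
        (\<phi> u, \<phi> v) \<in> parcs G \<longleftrightarrow> (u, v) \<in> parcs G"
      and \<phi>ab: "(\<phi> (fst a), \<phi> (snd a)) = b"
      using R ab by blast
    define h where "h = \<lparr>iso_verts = \<phi>, iso_arcs = map_prod \<phi> \<phi>,
      iso_head = snd, iso_tail = (fst :: 'a \<times> 'a \<Rightarrow> 'a)\<rparr>"
    have inj: "inj_on \<phi> (pverts G)" and im: "\<phi> ` pverts G = pverts G"
      using bij by (auto simp: bij_betw_def)
    have sub: "parcs G \<subseteq> pverts G \<times> pverts G"
      using arc_fst_in_verts arc_snd_in_verts by fastforce
    have injA: "inj_on (map_prod \<phi> \<phi>) (parcs G)"
      using map_prod_inj_on[OF inj inj] sub by (rule inj_on_subset)
    have A: "map_prod \<phi> \<phi> ` parcs G = parcs G"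
    proof
      show "map_prod \<phi> \<phi> ` parcs G \<subseteq> parcs G"
        using sub pres by auto
      show "parcs G \<subseteq> map_prod \<phi> \<phi> ` parcs G"
      proof
        fix e assume e: "e \<in> parcs G"
        then have "fst e \<in> \<phi> ` pverts G" "snd e \<in> \<phi> ` pverts G"
          using im arc_fst_in_verts arc_snd_in_verts by auto
        then obtain u v where uv: "u \<in> pverts G" "v \<in> pverts G" "e = (\<phi> u, \<phi> v)"
          by (metis imageE prod.collapse)
        then have "(u, v) \<in> parcs G" using e pres by auto
        then show "e \<in> map_prod \<phi> \<phi> ` parcs G" using uv by force
      qed
    qed
    have "pre_digraph.digraph_isomorphism (with_proj G) h"
      unfolding pre_digraph.digraph_isomorphism_def
      using inj injA wf_digraph by (simp add: h_def)
    moreover have "app_iso h (with_proj G) = with_proj G"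
      using im A by (simp add: app_iso_def h_def with_proj_def)
    ultimately show ?thesis
      using \<phi>ab unfolding digraph_automorphism_def
      by (intro exI[of _ h]) (auto simp: h_def map_prod_def split: prod.split)
  qed
  then show ?L unfolding arc_transitive_def by simp
qed

abbreviation unit_square :: "(real \<times> real) measure" where
  "unit_square \<equiv> lebesgue_on ({0..1} \<times> {0..1})"

text \<open>Kernels are curried functions on the plane; only their values on the unit square matter.
  Measurability is Lebesgue measurability, which includes Borel measurable kernels.\<close>

definition tournamenton :: "(real \<Rightarrow> real \<Rightarrow> real) \<Rightarrow> bool" where
  "tournamenton W \<longleftrightarrow>
    (\<lambda>(x, y). W x y) \<in> borel_measurable unit_square \<and>
    (\<forall>x \<in> {0..1}. \<forall>y \<in> {0..1}. 0 \<le> W x y \<and> W x y \<le> 1) \<and>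
    (AE (x, y) in unit_square. W x y + W y x = 1)"

text \<open>Lebesgue measure on the cube of points indexed by a finite set. The completion is needed:
  if \<open>W\<close> is only Lebesgue measurable, then \<open>\<lambda>x. W (x s) (x t)\<close> need not be measurable
  with respect to the product sigma-algebra.\<close>

definition unit_cube :: "'a set \<Rightarrow> ('a \<Rightarrow> real) measure" where
  "unit_cube V = completion (Pi\<^sub>M V (\<lambda>_. restrict_space lborel {0..1}))"

definition tournament_density :: "'a pair_pre_digraph \<Rightarrow> (real \<Rightarrow> real \<Rightarrow> real) \<Rightarrow> real" where
  "tournament_density T W =
    (\<integral>z. (\<Prod>(s, t) \<in> parcs T. W (z s) (z t)) \<partial>unit_cube (pverts T))"

text \<open>For \<open>a = (i, j)\<close> the coordinates \<open>i\<close> and \<open>j\<close> are set to \<open>x\<close> and \<open>y\<close>. For a null set of pairs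
  \<open>(x, y)\<close> the integrand may fail to be measurable, and the integral is then \<open>0\<close> by convention;
  this is harmless, since the density is only used up to null sets.\<close>

definition arc_rooted_density ::
    "'a pair_pre_digraph \<Rightarrow> (real \<Rightarrow> real \<Rightarrow> real) \<Rightarrow> 'a \<times> 'a \<Rightarrow> real \<Rightarrow> real \<Rightarrow> real" where
  "arc_rooted_density T W a x y =
    (\<integral>z. (\<Prod>(s, t) \<in> parcs T.
        W ((z(fst a := x, snd a := y)) s) ((z(fst a := x, snd a := y)) t))
      \<partial>unit_cube (pverts T - {fst a, snd a}))"

definition ae_constant :: "(real \<Rightarrow> real \<Rightarrow> real) \<Rightarrow> bool" where
  "ae_constant f \<longleftrightarrow> (\<exists>c. AE (x, y) in unit_square. f x y = c)"

end

theory Submission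
  imports Defs "HOL-Probability.Infinite_Product_Measure"
begin

text \<open>
  Write \<open>F z\<close> for the product of \<open>W (z s) (z t)\<close> over all arcs \<open>(s, t)\<close> and \<open>t\<close> for its integral, the
  density of the tournament, and suppose that \<open>t > 0\<close>. If the density rooted at the arc \<open>(i, j)\<close> is
  constant, the constant is \<open>t\<close>, and it says that under the probability density \<open>F / t\<close> the
  pair \<open>(z i, z j)\<close> is uniformly distributed. Therefore \<open>F\<close> and the constant \<open>t\<close> have the same integrals
  against every function of \<open>z i\<close> and \<open>z j\<close> (\<open>nn_integral_uniform_marginal\<close>). Now \<open>ln F\<close> is the sum of
  the functions \<open>ln (W (z i) (z j))\<close>; if all arcs have constant rooted densities, the integral of
  \<open>(F - t) * ln F\<close> is zero, and hence so is the integral of \<open>(F - t) * (ln F - ln t)\<close>. This integrand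
  is nonnegative, and so \<open>F = t\<close> almost everywhere (\<open>arc_product_AE_constant\<close>).

  It remains to see that a tournamenton with \<open>F\<close> constant and positive is one half. Fixing all
  coordinates but the ends of one arc shows that \<open>W x y = a x * b y\<close> (\<open>AE_rank_one_factorization\<close>), and
  the equation \<open>a x * b y + a y * b x = 1\<close> forces \<open>a\<close> and \<open>b\<close> to be constant (\<open>AE_half_if_rank_one\<close>).

  In an arc-transitive tournament, renaming the coordinates by an automorphism turns the density rooted
  at one arc into the density rooted at any other (\<open>nn_integral_arc_rooted_automorphism\<close>), so that one
  constant density makes all of them constant.

  All of this takes place over an arbitrary probability space, for a measurable kernel. A tournamenton is
  only Lebesgue measurable; it is replaced by a Borel measurable version, which has the same density
  and almost everywhere the same rooted densities (\<open>tournamenton_Borel_version\<close>).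
\<close>

definition arc_product :: "('v \<times> 'v) set \<Rightarrow> ('p \<Rightarrow> 'p \<Rightarrow> 'c::comm_monoid_mult) \<Rightarrow> ('v \<Rightarrow> 'p) \<Rightarrow> 'c" where
  "arc_product A W z = (\<Prod>(s, t)\<in>A. W (z s) (z t))"

lemma arc_ends:
  assumes "e \<in> A" "A \<subseteq> V \<times> V" "\<And>v. (v, v) \<notin> A"
  shows "fst e \<in> V" "snd e \<in> V" "fst e \<noteq> snd e"
proof -
  obtain s t where e: "e = (s, t)" by (rule prod.exhaust)
  show "fst e \<in> V" "snd e \<in> V" using assms(1,2) unfolding e by auto
  show "fst e \<noteq> snd e" using assms(1) assms(3)[of s] unfolding e by auto
qed

section \<open>The uniform measure on a cube with two coordinates separated\<close>

context prob_space
begin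

abbreviation "cube V \<equiv> Pi\<^sub>M V (\<lambda>_. M)"

lemma prob_space_cube: "prob_space (cube V)"
  by (intro prob_space_PiM prob_space_axioms)

text \<open>Rooting at an arc means separating two coordinates of the cube from the others. The insertion map
  \<open>((x, y), z) \<mapsto> z(i := x, j := y)\<close> identifies the product of the square and the smaller cube with
  the whole cube; the lemmas that follow are the forms of this identification that are needed.\<close>

lemma measurable_set_two_coordinates:
  assumes "i \<in> V" "j \<in> V"
  shows "(\<lambda>(p, z). z(i := fst p, j := snd p)) \<in>
    measurable ((M \<Otimes>\<^sub>M M) \<Otimes>\<^sub>M cube (V - {i, j})) (cube V)"
proof -
  have "(\<lambda>q. (snd q)(i := fst (fst q))) \<in>
      measurable ((M \<Otimes>\<^sub>M M) \<Otimes>\<^sub>M cube (V - {i, j})) (cube (insert i (V - {i, j})))"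
    by (rule measurable_fun_upd[where J="V - {i, j}"]) auto
  then have "(\<lambda>q. (snd q)(i := fst (fst q), j := snd (fst q))) \<in>
      measurable ((M \<Otimes>\<^sub>M M) \<Otimes>\<^sub>M cube (V - {i, j})) (cube V)"
    by (rule measurable_fun_upd[where J="insert i (V - {i, j})", rotated]) (use assms in auto)
  then show ?thesis by (simp add: case_prod_unfold)
qed

lemma measurable_set_two_coordinates_at:
  assumes "i \<in> V" "j \<in> V" "p \<in> space (M \<Otimes>\<^sub>M M)"
  shows "(\<lambda>z. z(i := fst p, j := snd p)) \<in> measurable (cube (V - {i, j})) (cube V)"
  using measurable_compose[OF measurable_Pair1'[OF assms(3)] measurable_set_two_coordinates[OF assms(1,2)]]
  by simp

lemma nn_integral_cube_split:
  assumes V: "finite V" "i \<in> V" "j \<in> V" "i \<noteq> j"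
    and f[measurable]: "f \<in> borel_measurable (cube V)"
  shows "(\<integral>\<^sup>+z. f z \<partial>cube V) =
    (\<integral>\<^sup>+p. \<integral>\<^sup>+z. f (z(i := fst p, j := snd p)) \<partial>cube (V - {i, j}) \<partial>(M \<Otimes>\<^sub>M M))"
proof -
  interpret product_sigma_finite "\<lambda>_. M"
    by (intro product_sigma_finite.intro sigma_finite_measure_axioms)
  interpret P: pair_sigma_finite M M
    by (intro pair_sigma_finite.intro sigma_finite_measure_axioms)
  interpret C: prob_space "cube (V - {i, j})" by (rule prob_space_cube)
  note upd = measurable_compose[OF measurable_set_two_coordinates[OF V(2,3)] f]
  have m: "(\<lambda>p. \<integral>\<^sup>+z. f (z(i := fst p, j := snd p)) \<partial>cube (V - {i, j})) \<in> borel_measurable (M \<Otimes>\<^sub>M M)"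
    using upd by (intro C.borel_measurable_nn_integral) (simp add: case_prod_unfold)
  have eq: "insert j (V - {j}) = V" "insert i (V - {i, j}) = V - {j}" using V by auto
  have "(\<integral>\<^sup>+z. f z \<partial>cube V) = (\<integral>\<^sup>+y. \<integral>\<^sup>+z. f (z(j := y)) \<partial>cube (V - {j}) \<partial>M)"
    using product_nn_integral_insert_rev[of "V - {j}" j f, unfolded eq] V f by simp
  also have "\<dots> = (\<integral>\<^sup>+y. \<integral>\<^sup>+x. \<integral>\<^sup>+z. f (z(i := x, j := y)) \<partial>cube (V - {i, j}) \<partial>M \<partial>M)"
  proof (intro nn_integral_cong)
    fix y assume y: "y \<in> space M"
    have "(\<lambda>z. z(j := y)) \<in> measurable (cube (V - {j})) (cube V)"
      by (rule measurable_fun_upd[where J="V - {j}"]) (use V y in auto)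
    from measurable_compose[OF this f] show "(\<integral>\<^sup>+z. f (z(j := y)) \<partial>cube (V - {j})) =
        (\<integral>\<^sup>+x. \<integral>\<^sup>+z. f (z(i := x, j := y)) \<partial>cube (V - {i, j}) \<partial>M)"
      using product_nn_integral_insert_rev[of "V - {i, j}" i "\<lambda>z. f (z(j := y))", unfolded eq] V
      by simp
  qed
  also have "\<dots> = (\<integral>\<^sup>+p. \<integral>\<^sup>+z. f (z(i := fst p, j := snd p)) \<partial>cube (V - {i, j}) \<partial>(M \<Otimes>\<^sub>M M))"
    by (subst P.nn_integral_snd[symmetric]) (use m in \<open>simp_all add: split_beta\<close>)
  finally show ?thesis .
qed

text \<open>The predicate need not be measurable: it is enough to split the indicator of a measurable null set
  that contains the exceptional points.\<close>

lemma AE_cube_split: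
  assumes V: "finite V" "i \<in> V" "j \<in> V" "i \<noteq> j" and P: "AE z in cube V. P z"
  shows "AE p in M \<Otimes>\<^sub>M M. AE z in cube (V - {i, j}). P (z(i := fst p, j := snd p))"
proof -
  interpret C: prob_space "cube (V - {i, j})" by (rule prob_space_cube)
  from P obtain N where N: "{z \<in> space (cube V). \<not> P z} \<subseteq> N" "emeasure (cube V) N = 0"
    "N \<in> sets (cube V)" by (rule AE_E)
  note [measurable] = N(3)
  note upd = measurable_compose[OF measurable_set_two_coordinates[OF V(2,3)], of "indicator N" borel]
  have m: "(\<lambda>p. \<integral>\<^sup>+z. indicator N (z(i := fst p, j := snd p)) \<partial>cube (V - {i, j})) \<in> borel_measurable (M \<Otimes>\<^sub>M M)"
    using upd by (intro C.borel_measurable_nn_integral) (simp add: case_prod_unfold)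
  have "(\<integral>\<^sup>+p. \<integral>\<^sup>+z. indicator N (z(i := fst p, j := snd p)) \<partial>cube (V - {i, j}) \<partial>(M \<Otimes>\<^sub>M M)) = 0"
    using nn_integral_cube_split[OF V, of "indicator N"] N by simp
  then have "AE p in M \<Otimes>\<^sub>M M. (\<integral>\<^sup>+z. indicator N (z(i := fst p, j := snd p)) \<partial>cube (V - {i, j})) = 0"
    using m by (simp add: nn_integral_0_iff_AE)
  moreover have "AE p in M \<Otimes>\<^sub>M M. p \<in> space (M \<Otimes>\<^sub>M M)" by simp
  ultimately show ?thesis
  proof eventually_elim
    case (elim p)
    then have p: "fst p \<in> space M" "snd p \<in> space M" by (auto simp: space_pair_measure)
    have s: "(\<lambda>z. z(i := fst p, j := snd p)) \<in> measurable (cube (V - {i, j})) (cube V)"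
      by (rule measurable_set_two_coordinates_at[OF V(2,3) elim(2)])
    have "(\<lambda>z. indicator N (z(i := fst p, j := snd p)) :: ennreal) \<in> borel_measurable (cube (V - {i, j}))"
      using measurable_compose[OF s, of "indicator N" borel] by simp
    then have "AE z in cube (V - {i, j}). indicator N (z(i := fst p, j := snd p)) = (0::ennreal)"
      using elim(1) nn_integral_0_iff_AE by blast
    moreover have "AE z in cube (V - {i, j}). z \<in> space (cube (V - {i, j}))" by simp
    ultimately show ?case
    proof eventually_elim
      case (elim z)
      then show ?case using measurable_space[OF s, of z] N(1) by (auto split: split_indicator_asm)
    qed
  qed
qed

lemma AE_cube_coordinates:
  assumes V: "finite V" "i \<in> V" "j \<in> V" "i \<noteq> j" and P: "AE p in M \<Otimes>\<^sub>M M. P p"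
  shows "AE z in cube V. P (z i, z j)"
proof -
  interpret C: prob_space "cube (V - {i, j})" by (rule prob_space_cube)
  from P obtain N where N: "{z \<in> space (M \<Otimes>\<^sub>M M). \<not> P z} \<subseteq> N" "emeasure (M \<Otimes>\<^sub>M M) N = 0"
    "N \<in> sets (M \<Otimes>\<^sub>M M)" by (rule AE_E)
  note [measurable] = N(3)
  have [measurable]: "(\<lambda>z. (z i, z j)) \<in> measurable (cube V) (M \<Otimes>\<^sub>M M)"
    using V by measurable
  have "(\<integral>\<^sup>+z. indicator N (z i, z j) \<partial>cube V) = 0"
    using N by (subst nn_integral_cube_split[OF V]) (simp_all add: V C.emeasure_space_1)
  then have "AE z in cube V. indicator N (z i, z j) = (0::ennreal)"
    by (simp add: nn_integral_0_iff_AE)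
  moreover have "AE z in cube V. z \<in> space (cube V)" by simp
  ultimately show ?thesis
  proof eventually_elim
    case (elim z)
    then show ?case using V N(1) by (auto simp: space_pair_measure space_PiM PiE_def Pi_def split: split_indicator_asm)
  qed
qed

text \<open>If the integral of \<open>f\<close> over the other coordinates is the constant \<open>c\<close>, then the measure with
  density \<open>f\<close> has \<open>c\<close> times the uniform law as its marginal in the coordinates \<open>i\<close> and \<open>j\<close>. Hence
  it cannot be told apart from \<open>c\<close> times the uniform measure by functions of these coordinates.\<close>

lemma nn_integral_uniform_marginal:
  assumes V: "finite V" "i \<in> V" "j \<in> V" "i \<noteq> j"
    and f[measurable]: "f \<in> borel_measurable (cube V)"
    and g[measurable]: "case_prod g \<in> borel_measurable (M \<Otimes>\<^sub>M M)"
    and c: "AE p in M \<Otimes>\<^sub>M M. (\<integral>\<^sup>+z. f (z(i := fst p, j := snd p)) \<partial>cube (V - {i, j})) = c"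
  shows "(\<integral>\<^sup>+z. f z * g (z i) (z j) \<partial>cube V) = c * (\<integral>\<^sup>+z. g (z i) (z j) \<partial>cube V)"
proof -
  interpret C: prob_space "cube (V - {i, j})" by (rule prob_space_cube)
  have coord: "(\<lambda>z. (z i, z j)) \<in> measurable (cube V) (M \<Otimes>\<^sub>M M)"
    using V by measurable
  have gm[measurable]: "(\<lambda>z. g (z i) (z j)) \<in> borel_measurable (cube V)"
    using measurable_compose[OF coord g] by simp
  have "(\<integral>\<^sup>+z. f z * g (z i) (z j) \<partial>cube V) =
      (\<integral>\<^sup>+p. \<integral>\<^sup>+z. f (z(i := fst p, j := snd p)) * case_prod g p \<partial>cube (V - {i, j}) \<partial>(M \<Otimes>\<^sub>M M))"
    by (subst nn_integral_cube_split[OF V]) (use V in \<open>simp_all add: case_prod_unfold\<close>)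
  also have "\<dots> = (\<integral>\<^sup>+p. c * case_prod g p \<partial>(M \<Otimes>\<^sub>M M))"
  proof (rule nn_integral_cong_AE)
    have "AE p in M \<Otimes>\<^sub>M M. p \<in> space (M \<Otimes>\<^sub>M M)" by simp
    with c show "AE p in M \<Otimes>\<^sub>M M. (\<integral>\<^sup>+z. f (z(i := fst p, j := snd p)) * case_prod g p \<partial>cube (V - {i, j})) =
        c * case_prod g p"
    proof eventually_elim
      case (elim p)
      have "(\<lambda>z. f (z(i := fst p, j := snd p))) \<in> borel_measurable (cube (V - {i, j}))"
        by (rule measurable_compose[OF measurable_set_two_coordinates_at[OF V(2,3) elim(2)] f])
      then show ?case using elim(1) by (simp add: nn_integral_multc)
    qed
  qed
  also have "\<dots> = c * (\<integral>\<^sup>+p. case_prod g p \<partial>(M \<Otimes>\<^sub>M M))"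
    by (simp add: nn_integral_cmult)
  also have "(\<integral>\<^sup>+p. case_prod g p \<partial>(M \<Otimes>\<^sub>M M)) = (\<integral>\<^sup>+z. g (z i) (z j) \<partial>cube V)"
    by (subst nn_integral_cube_split[OF V]) (use V in \<open>simp_all add: C.emeasure_space_1 case_prod_unfold\<close>)
  finally show ?thesis .
qed

section \<open>Constant marginals along arcs force a constant product\<close>

lemma measurable_arc_product:
  fixes W :: "'a \<Rightarrow> 'a \<Rightarrow> real"
  assumes "case_prod W \<in> borel_measurable (M \<Otimes>\<^sub>M M)" "A \<subseteq> V \<times> V"
  shows "arc_product A W \<in> borel_measurable (cube V)"
  unfolding arc_product_def[abs_def]
proof (rule borel_measurable_prod)
  fix e assume "e \<in> A"
  then have "fst e \<in> V" "snd e \<in> V" using assms by auto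
  then have "(\<lambda>z. (z (fst e), z (snd e))) \<in> measurable (cube V) (M \<Otimes>\<^sub>M M)" by measurable
  from measurable_compose[OF this assms(1)]
  show "(\<lambda>z. case e of (s, t) \<Rightarrow> W (z s) (z t)) \<in> borel_measurable (cube V)"
    by (simp add: case_prod_unfold)
qed

text \<open>The symmetrized relative entropy of the probability density \<open>F / t\<close> and the uniform density is the
  integral of \<open>(F / t - 1) * ln (F / t)\<close>. Since \<open>ln F\<close> is a sum of functions of two coordinates
  \<open>i\<close>, \<open>j\<close>, one for each arc, and since both densities have the same marginals along arcs, this
  entropy is zero. The integrand is nonnegative and vanishes only where \<open>F = t\<close>.

  Both integrals of \<open>ln F\<close> must be finite for this cancellation. One of them is: \<open>- F * ln F\<close> is at
  most \<open>1\<close>. By equality of the marginals the other one is then finite as well, because \<open>t > 0\<close>. The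
  equality itself is obtained with nonnegative extended integrals of \<open>- ln W\<close>.\<close>

lemma arc_product_AE_constant:
  fixes W :: "'a \<Rightarrow> 'a \<Rightarrow> real"
  assumes V: "finite V" and A: "A \<subseteq> V \<times> V" "\<And>v. (v, v) \<notin> A" "A \<noteq> {}"
    and W[measurable]: "case_prod W \<in> borel_measurable (M \<Otimes>\<^sub>M M)" and W01: "\<And>x y. 0 \<le> W x y" "\<And>x y. W x y \<le> 1"
    and t: "t > 0" and marg: "\<And>i j. (i, j) \<in> A \<Longrightarrow> AE p in M \<Otimes>\<^sub>M M.
      (\<integral>\<^sup>+z. ennreal (arc_product A W (z(i := fst p, j := snd p))) \<partial>cube (V - {i, j})) = ennreal t"
  shows "AE z in cube V. arc_product A W z = t"
proof -
  interpret C: prob_space "cube V" by (rule prob_space_cube)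
  define F where "F = arc_product A W"
  have finA: "finite A" using A(1) V by (meson finite_SigmaI finite_subset)
  have Fm[measurable]: "F \<in> borel_measurable (cube V)"
    unfolding F_def by (rule measurable_arc_product[OF W A(1)])
  have F01: "0 \<le> F z" "F z \<le> 1" for z
    unfolding F_def arc_product_def by (auto intro!: prod_nonneg prod_le_1 W01)
  have arc: "(\<integral>\<^sup>+z. ennreal (F z) * g (z i) (z j) \<partial>cube V) = ennreal t * (\<integral>\<^sup>+z. g (z i) (z j) \<partial>cube V)"
    if "(i, j) \<in> A" "case_prod g \<in> borel_measurable (M \<Otimes>\<^sub>M M)" for i j g
    by (rule nn_integral_uniform_marginal)
      (use V A that marg[OF that(1)] in \<open>auto simp: F_def[symmetric]\<close>)
  obtain i0 j0 where e0: "(i0, j0) \<in> A" using A(3) by auto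
  have intF: "(\<integral>\<^sup>+z. ennreal (F z) \<partial>cube V) = ennreal t"
    using arc[OF e0, of "\<lambda>_ _. 1"] by (simp add: C.emeasure_space_1)
  have coord: "(\<lambda>z. (z i, z j)) \<in> measurable (cube V) (M \<Otimes>\<^sub>M M)" if "(i, j) \<in> A" for i j
    using that A(1) by (intro measurable_Pair measurable_component_singleton) auto
  have Wm[measurable]: "(\<lambda>z. W (z i) (z j)) \<in> borel_measurable (cube V)" if "(i, j) \<in> A" for i j
    using measurable_compose[OF coord[OF that] W] by simp
  \<comment> \<open>The set where a factor vanishes has measure zero for the density \<open>F\<close>, hence also for the
    uniform measure. This makes the logarithms meaningful almost everywhere.\<close>
  have Wpos: "AE z in cube V. W (z i) (z j) > 0" if e: "(i, j) \<in> A" for i j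
  proof -
    let ?g = "\<lambda>x y. indicator {0} (W x y) :: ennreal"
    have F0: "ennreal (F z) * ?g (z i) (z j) = 0" for z
    proof (cases "W (z i) (z j) = 0")
      case True
      then have "F z = 0"
        unfolding F_def arc_product_def using e by (intro prod_zero[OF finA] bexI[of _ "(i, j)"]) auto
      then show ?thesis by simp
    qed simp
    then have "ennreal t * (\<integral>\<^sup>+z. ?g (z i) (z j) \<partial>cube V) = (\<integral>\<^sup>+z. 0 \<partial>cube V)"
      using W by (subst arc[OF e, of ?g, symmetric]) (simp_all only: F0 case_prod_unfold, measurable)
    then have "(\<integral>\<^sup>+z. ?g (z i) (z j) \<partial>cube V) = 0"
      using t by (auto simp: ennreal_eq_0_iff)
    then have "AE z in cube V. ?g (z i) (z j) = 0"
      using Wm[OF e] by (subst (asm) nn_integral_0_iff_AE) auto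
    then show ?thesis
      by eventually_elim (use W01(1) in \<open>auto split: split_indicator_asm simp: less_le\<close>)
  qed
  have "AE z in cube V. \<forall>(i, j)\<in>A. W (z i) (z j) > 0"
    using finA Wpos by (subst AE_finite_all) auto
  then have ae: "AE z in cube V. F z > 0 \<and> (\<Sum>(i, j)\<in>A. ennreal (- ln (W (z i) (z j)))) = ennreal (- ln (F z))"
  proof eventually_elim
    case (elim z)
    then have pos: "\<And>e. e \<in> A \<Longrightarrow> (case e of (i, j) \<Rightarrow> W (z i) (z j)) > 0" by auto
    then have 1: "F z > 0" by (simp add: F_def arc_product_def prod_pos)
    have "(\<Sum>(i, j)\<in>A. ennreal (- ln (W (z i) (z j)))) = ennreal (\<Sum>(i, j)\<in>A. - ln (W (z i) (z j)))"
      unfolding case_prod_unfold using pos W01 by (subst sum_ennreal) (auto simp: case_prod_unfold)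
    also have "(\<Sum>(i, j)\<in>A. - ln (W (z i) (z j))) = - ln (F z)"
      unfolding F_def arc_product_def using pos
      by (subst ln_prod) (fastforce simp: sum_negf case_prod_unfold intro: finA)+
    finally show ?case using 1 by simp
  qed
  define h where "h z = - ln (F z)" for z
  have hm[measurable]: "h \<in> borel_measurable (cube V)" unfolding h_def[abs_def] by measurable
  have intFh: "(\<integral>\<^sup>+z. ennreal (F z) * ennreal (h z) \<partial>cube V) = ennreal t * (\<integral>\<^sup>+z. ennreal (h z) \<partial>cube V)"
  proof -
    let ?l = "\<lambda>x y. ennreal (- ln (W x y))"
    have lm: "(\<lambda>z. ?l (z (fst e)) (z (snd e))) \<in> borel_measurable (cube V)" if "e \<in> A" for e
    proof -
      have "(fst e, snd e) \<in> A" using that by simp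
      note [measurable] = Wm[OF this]
      show ?thesis by measurable
    qed
    have "(\<integral>\<^sup>+z. ennreal (F z) * ennreal (h z) \<partial>cube V) =
        (\<integral>\<^sup>+z. (\<Sum>e\<in>A. ennreal (F z) * ?l (z (fst e)) (z (snd e))) \<partial>cube V)"
      by (rule nn_integral_cong_AE, use ae in eventually_elim)
        (simp add: h_def case_prod_unfold sum_distrib_left[symmetric])
    also have "\<dots> = (\<Sum>e\<in>A. \<integral>\<^sup>+z. ennreal (F z) * ?l (z (fst e)) (z (snd e)) \<partial>cube V)"
      by (rule nn_integral_sum) (use lm in measurable)
    also have "\<dots> = (\<Sum>e\<in>A. ennreal t * (\<integral>\<^sup>+z. ?l (z (fst e)) (z (snd e)) \<partial>cube V))"
      by (intro sum.cong refl arc) (auto simp: case_prod_unfold)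
    also have "\<dots> = ennreal t * (\<integral>\<^sup>+z. (\<Sum>e\<in>A. ?l (z (fst e)) (z (snd e))) \<partial>cube V)"
      by (subst nn_integral_sum) (use lm in \<open>auto simp: sum_distrib_left\<close>)
    also have "(\<integral>\<^sup>+z. (\<Sum>e\<in>A. ?l (z (fst e)) (z (snd e))) \<partial>cube V) = (\<integral>\<^sup>+z. ennreal (h z) \<partial>cube V)"
      by (rule nn_integral_cong_AE, use ae in eventually_elim) (simp add: h_def case_prod_unfold)
    finally show ?thesis .
  qed
  have h0: "AE z in cube V. 0 \<le> h z"
    using ae by eventually_elim (use F01 in \<open>auto simp: h_def\<close>)
  have Fh1: "AE z in cube V. F z * h z \<le> 1"
    using ae
  proof eventually_elim
    case (elim z)
    then have "- ln (F z) \<le> 1 / F z"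
      using ln_le_minus_one[of "1 / F z"] by (auto simp: ln_div)
    then show ?case using elim by (simp add: h_def field_simps)
  qed
  have Fh0: "AE z in cube V. 0 \<le> F z * h z"
    using h0 by eventually_elim (simp add: F01)
  have Fh_int: "integrable (cube V) (\<lambda>z. F z * h z)"
    by (rule C.integrable_const_bound[where B=1], use Fh1 Fh0 in eventually_elim) auto
  have Fhnn: "(\<integral>\<^sup>+z. ennreal (F z) * ennreal (h z) \<partial>cube V) = ennreal (\<integral>z. F z * h z \<partial>cube V)"
    using nn_integral_eq_integral[OF Fh_int Fh0] F01 by (simp add: ennreal_mult')
  have "ennreal t * (\<integral>\<^sup>+z. ennreal (h z) \<partial>cube V) < \<infinity>"
    unfolding intFh[symmetric] Fhnn by simp
  then have "(\<integral>\<^sup>+z. ennreal (h z) \<partial>cube V) < \<infinity>"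
    using t by (auto simp: ennreal_mult_less_top)
  then have h_int: "integrable (cube V) h"
    using h0 by (intro integrableI_nonneg) auto
  have hnn: "(\<integral>\<^sup>+z. ennreal (h z) \<partial>cube V) = ennreal (\<integral>z. h z \<partial>cube V)"
    by (rule nn_integral_eq_integral[OF h_int h0])
  have eq: "(\<integral>z. F z * h z \<partial>cube V) = t * (\<integral>z. h z \<partial>cube V)"
  proof -
    have nn: "0 \<le> (\<integral>z. h z \<partial>cube V)" "0 \<le> (\<integral>z. F z * h z \<partial>cube V)"
      by (intro integral_nonneg_AE h0 Fh0)+
    have "ennreal (\<integral>z. F z * h z \<partial>cube V) = ennreal (t * (\<integral>z. h z \<partial>cube V))"
      unfolding Fhnn[symmetric] intFh hnn using t nn by (simp add: ennreal_mult)
    then show ?thesis using nn t by (subst (asm) ennreal_inj) auto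
  qed
  have F_int: "integrable (cube V) F"
    by (rule C.integrable_const_bound[where B=1]) (use F01 in auto)
  have F_eq: "(\<integral>z. F z \<partial>cube V) = t"
  proof -
    have "ennreal (\<integral>z. F z \<partial>cube V) = ennreal t"
      using nn_integral_eq_integral[OF F_int] F01 intF by simp
    then show ?thesis using t F01 by (subst (asm) ennreal_inj) (auto intro: integral_nonneg)
  qed
  let ?d = "\<lambda>z. (F z - t) * (ln (F z) - ln t)"
  have d_eq: "?d = (\<lambda>z. t * h z - F z * h z - ln t * F z + t * ln t)"
    by (auto simp: h_def algebra_simps)
  have d_int: "integrable (cube V) ?d"
    unfolding d_eq by (intro Bochner_Integration.integrable_add Bochner_Integration.integrable_diff
      integrable_mult_right h_int Fh_int F_int) auto
  have "(\<integral>z. ?d z \<partial>cube V) = 0"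
    unfolding d_eq using h_int Fh_int F_int by (simp add: eq F_eq C.prob_space)
  moreover have "AE z in cube V. 0 \<le> ?d z"
    using ae
  proof eventually_elim
    case (elim z)
    then show ?case using t
      by (cases "F z \<le> t") (auto intro: mult_nonpos_nonpos)
  qed
  ultimately have "AE z in cube V. ?d z = 0"
    using integral_nonneg_eq_0_iff_AE[OF d_int] by simp
  with ae show ?thesis
    by eventually_elim (use t in \<open>auto simp: F_def\<close>)
qed

section \<open>A product kernel that is skew-symmetric is one half\<close>

text \<open>Freeze all coordinates except \<open>i\<close> and \<open>j\<close> at a generic point. In the identity
  \<open>arc_product A W z = t\<close> the only factor that contains both free coordinates is then \<open>W x y\<close>,
  as \<open>(j, i)\<close> is not an arc; every other factor depends on \<open>x\<close> alone, on \<open>y\<close> alone, or on neither.\<close>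

lemma AE_rank_one_factorization:
  fixes W :: "'a \<Rightarrow> 'a \<Rightarrow> real"
  assumes V: "finite V" and A: "A \<subseteq> V \<times> V" and ij: "(i, j) \<in> A" "(j, i) \<notin> A" "i \<noteq> j"
    and W[measurable]: "case_prod W \<in> borel_measurable (M \<Otimes>\<^sub>M M)" and W0: "\<And>x y. 0 \<le> W x y"
    and t: "t > 0" and const: "AE z in cube V. arc_product A W z = t"
  obtains a b where "AE p in M \<Otimes>\<^sub>M M. a (fst p) > 0 \<and> b (snd p) > 0 \<and> W (fst p) (snd p) = a (fst p) * b (snd p)"
proof -
  interpret C: prob_space "cube (V - {i, j})" by (rule prob_space_cube)
  interpret MM: prob_space "M \<Otimes>\<^sub>M M" by (intro prob_space_pair prob_space_axioms)
  interpret P: pair_sigma_finite "M \<Otimes>\<^sub>M M" "cube (V - {i, j})"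
    by (intro pair_sigma_finite.intro MM.sigma_finite_measure_axioms C.sigma_finite_measure_axioms)
  have V': "i \<in> V" "j \<in> V" using A ij by auto
  have finA: "finite A" using A V by (meson finite_SigmaI finite_subset)
  have m: "arc_product A W \<in> borel_measurable (cube V)" by (rule measurable_arc_product[OF W A])
  have [measurable]: "(\<lambda>q. arc_product A W ((snd q)(i := fst (fst q), j := snd (fst q)))) \<in>
      borel_measurable ((M \<Otimes>\<^sub>M M) \<Otimes>\<^sub>M cube (V - {i, j}))"
    using measurable_compose[OF measurable_set_two_coordinates[OF V'] m] by (simp add: case_prod_unfold)
  have "AE p in M \<Otimes>\<^sub>M M. AE z in cube (V - {i, j}). arc_product A W (z(i := fst p, j := snd p)) = t"
    by (rule AE_cube_split[OF V V' ij(3) const])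
  then have "AE z in cube (V - {i, j}). AE p in M \<Otimes>\<^sub>M M. arc_product A W (z(i := fst p, j := snd p)) = t"
    by (rule P.AE_commute[THEN iffD1, rotated]) measurable
  then obtain z where z: "AE p in M \<Otimes>\<^sub>M M. arc_product A W (z(i := fst p, j := snd p)) = t"
    using eventually_happens'[OF C.ae_filter_bot] by blast
  define Ai where "Ai = {e \<in> A. e \<noteq> (i, j) \<and> (fst e = i \<or> snd e = i)}"
  define Aj where "Aj = {e \<in> A. e \<noteq> (i, j) \<and> (fst e = j \<or> snd e = j)}"
  define A0 where "A0 = {e \<in> A. fst e \<noteq> i \<and> snd e \<noteq> i \<and> fst e \<noteq> j \<and> snd e \<noteq> j}"
  define \<alpha> where "\<alpha> x = arc_product Ai W (z(i := x))" for x
  define \<beta> where "\<beta> y = arc_product Aj W (z(j := y))" for y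
  define \<gamma> where "\<gamma> = arc_product A0 W z"
  have split: "arc_product A W (z(i := x, j := y)) = W x y * \<alpha> x * \<beta> y * \<gamma>" for x y
  proof -
    let ?f = "\<lambda>e. W ((z(i := x, j := y)) (fst e)) ((z(i := x, j := y)) (snd e))"
    have dec: "A = insert (i, j) (Ai \<union> (Aj \<union> A0))" using ij by (auto simp: Ai_def Aj_def A0_def)
    have dis: "(i, j) \<notin> Ai \<union> (Aj \<union> A0)" "Ai \<inter> (Aj \<union> A0) = {}" "Aj \<inter> A0 = {}"
      using ij by (auto simp: Ai_def Aj_def A0_def)
    have fin: "finite Ai" "finite Aj" "finite A0" using finA by (auto simp: Ai_def Aj_def A0_def)
    have nij: "(i, j) \<notin> Ai" "(i, j) \<notin> Aj" "(i, j) \<notin> A0" using dis(1) by auto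
    have "arc_product A W (z(i := x, j := y)) = prod ?f A"
      by (simp add: arc_product_def case_prod_unfold)
    also have "\<dots> = ?f (i, j) * (prod ?f Ai * (prod ?f Aj * prod ?f A0))"
      by (subst dec, subst prod.insert) (use fin dis in \<open>simp_all add: prod.union_disjoint\<close>)
    also have "?f (i, j) = W x y" using ij by simp
    also have "prod ?f Ai = \<alpha> x"
      unfolding \<alpha>_def arc_product_def case_prod_unfold
      by (intro prod.cong refl) (use ij in \<open>auto simp: Ai_def\<close>)
    also have "prod ?f Aj = \<beta> y"
      unfolding \<beta>_def arc_product_def case_prod_unfold
      by (intro prod.cong refl) (use ij in \<open>auto simp: Aj_def\<close>)
    also have "prod ?f A0 = \<gamma>"
      unfolding \<gamma>_def arc_product_def case_prod_unfold
      by (intro prod.cong refl) (auto simp: A0_def)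
    finally show ?thesis by (simp only: mult_ac)
  qed
  have nn: "0 \<le> \<alpha> x" "0 \<le> \<beta> y" "0 \<le> \<gamma>" for x y
    unfolding \<alpha>_def \<beta>_def \<gamma>_def arc_product_def by (auto intro!: prod_nonneg W0)
  show thesis
  proof (rule that[of "\<lambda>x. t / (\<alpha> x * \<gamma>)" "\<lambda>y. 1 / \<beta> y"])
    show "AE p in M \<Otimes>\<^sub>M M. 0 < t / (\<alpha> (fst p) * \<gamma>) \<and> 0 < 1 / \<beta> (snd p) \<and>
        W (fst p) (snd p) = t / (\<alpha> (fst p) * \<gamma>) * (1 / \<beta> (snd p))"
      using z
    proof eventually_elim
      case (elim p)
      then have eq: "W (fst p) (snd p) * \<alpha> (fst p) * \<beta> (snd p) * \<gamma> = t" by (simp add: split)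
      then have "\<alpha> (fst p) \<noteq> 0" "\<beta> (snd p) \<noteq> 0" "\<gamma> \<noteq> 0" using t by auto
      then have "\<alpha> (fst p) > 0" "\<beta> (snd p) > 0" "\<gamma> > 0" using nn by (auto simp: less_le)
      then show ?case using eq t by (auto simp: field_simps)
    qed
  qed
qed

lemma AE_pair_swap:
  assumes "AE p in M \<Otimes>\<^sub>M M. P (fst p) (snd p)"
  shows "AE p in M \<Otimes>\<^sub>M M. P (snd p) (fst p)"
proof -
  interpret pair_sigma_finite M M
    by (intro pair_sigma_finite.intro sigma_finite_measure_axioms)
  have "AE p in distr (M \<Otimes>\<^sub>M M) (M \<Otimes>\<^sub>M M) (\<lambda>(x, y). (y, x)). P (fst p) (snd p)"
    by (subst distr_pair_swap[symmetric]) (rule assms)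
  then show ?thesis by (rule AE_distrD[rotated, where f="\<lambda>(x, y). (y, x)", THEN AE_mp]) (auto simp: case_prod_unfold)
qed

lemma AE_pair_fst:
  assumes "AE x in M. P x"
  shows "AE p in M \<Otimes>\<^sub>M M. P (fst p)"
proof -
  have "AE x in distr (M \<Otimes>\<^sub>M M) M fst. P x"
    by (subst distr_pair_fst) (rule assms)
  then show ?thesis by (rule AE_distrD[rotated]) simp
qed

lemma AE_pair_snd:
  assumes "AE x in M. P x"
  shows "AE p in M \<Otimes>\<^sub>M M. P (snd p)"
  using AE_pair_swap[of "\<lambda>x y. P x"] AE_pair_fst[OF assms] by simp

text \<open>Put \<open>\<phi> = a / b\<close> and \<open>\<psi> = 1 / b\<close>. The skew-symmetry becomes \<open>\<phi> x + \<phi> y = \<psi> x * \<psi> y\<close>. If \<open>\<psi>\<close>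
  took different values at two generic points \<open>x\<close> and \<open>x'\<close>, the difference of the two equations
  would determine \<open>\<psi> y\<close> for almost every \<open>y\<close>. So \<open>\<psi>\<close> is almost everywhere constant in any case, and
  then so are \<open>\<phi>\<close> and \<open>W\<close>.\<close>

lemma AE_half_if_rank_one:
  fixes W :: "'a \<Rightarrow> 'a \<Rightarrow> real"
  assumes ab: "AE p in M \<Otimes>\<^sub>M M. a (fst p) > 0 \<and> b (snd p) > 0 \<and> W (fst p) (snd p) = a (fst p) * b (snd p)"
    and skew: "AE p in M \<Otimes>\<^sub>M M. W (fst p) (snd p) + W (snd p) (fst p) = 1"
  shows "AE p in M \<Otimes>\<^sub>M M. W (fst p) (snd p) = 1 / 2"
proof -
  interpret P: pair_sigma_finite M M
    by (intro pair_sigma_finite.intro sigma_finite_measure_axioms)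
  define \<phi> where "\<phi> x = a x / b x" for x
  define \<psi> where "\<psi> x = 1 / b x" for x
  have "AE p in M \<Otimes>\<^sub>M M. \<phi> (fst p) + \<phi> (snd p) = \<psi> (fst p) * \<psi> (snd p)"
    using ab AE_pair_swap[of "\<lambda>x y. a x > 0 \<and> b y > 0 \<and> W x y = a x * b y", OF ab] skew
  proof eventually_elim
    case (elim p)
    then have "a (fst p) * b (snd p) + a (snd p) * b (fst p) = 1" by simp
    with elim show ?case by (simp add: \<phi>_def \<psi>_def field_simps)
  qed
  from P.AE_pair[OF this]
  have good: "AE x in M. AE y in M. \<phi> x + \<phi> y = \<psi> x * \<psi> y" by simp
  have "\<exists>k. AE y in M. \<psi> y = k"
  proof (cases "\<exists>x x'. \<psi> x \<noteq> \<psi> x' \<and> (AE y in M. \<phi> x + \<phi> y = \<psi> x * \<psi> y) \<and> (AE y in M. \<phi> x' + \<phi> y = \<psi> x' * \<psi> y)")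
    case True
    then obtain x x' where ne: "\<psi> x \<noteq> \<psi> x'" and *: "AE y in M. \<phi> x + \<phi> y = \<psi> x * \<psi> y"
      "AE y in M. \<phi> x' + \<phi> y = \<psi> x' * \<psi> y" by blast
    from * have "AE y in M. \<psi> y = (\<phi> x - \<phi> x') / (\<psi> x - \<psi> x')"
    proof eventually_elim
      case (elim y)
      then have "\<psi> y * (\<psi> x - \<psi> x') = \<phi> x - \<phi> x'" by (simp add: algebra_simps)
      then show ?case using ne by (simp add: eq_divide_eq)
    qed
    then show ?thesis ..
  next
    case False
    obtain x where x: "AE y in M. \<phi> x + \<phi> y = \<psi> x * \<psi> y"
      using eventually_happens'[OF ae_filter_bot good] by blast
    have "AE y in M. \<psi> y = \<psi> x"
      using good by eventually_elim (use False x in metis)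
    then show ?thesis ..
  qed
  then obtain k where k: "AE y in M. \<psi> y = k" ..
  obtain x where "AE y in M. \<phi> x + \<phi> y = \<psi> x * \<psi> y"
    using eventually_happens'[OF ae_filter_bot good] by blast
  with k have l: "AE y in M. \<phi> y = \<psi> x * k - \<phi> x"
    by eventually_elim (auto simp: algebra_simps)
  define q where "q = (\<psi> x * k - \<phi> x) / (k * k)"
  have Wq: "AE p in M \<Otimes>\<^sub>M M. W (fst p) (snd p) = q"
    using ab AE_pair_fst[OF k] AE_pair_snd[OF k] AE_pair_fst[OF l] AE_pair_swap[OF ab]
  proof eventually_elim
    case (elim p)
    have "W (fst p) (snd p) = \<phi> (fst p) / \<psi> (fst p) * (1 / \<psi> (snd p))"
      using elim(1,5) by (simp add: \<phi>_def \<psi>_def)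
    also have "\<dots> = q" unfolding elim(2,3,4) q_def by simp
    finally show ?case .
  qed
  from Wq AE_pair_swap[of "\<lambda>x y. W x y = q", OF Wq] skew show ?thesis
    by eventually_elim auto
qed

section \<open>Invariance of arc products\<close>

text \<open>A null set of pairs may be ignored along every arc, because the two ends are distinct coordinates.\<close>

lemma AE_arc_product_cong:
  assumes V: "finite V" and A: "A \<subseteq> V \<times> V" "\<And>v. (v, v) \<notin> A"
    and eq: "AE p in M \<Otimes>\<^sub>M M. W (fst p) (snd p) = W' (fst p) (snd p)"
  shows "AE z in cube V. arc_product A W z = arc_product A W' z"
proof -
  have finA: "finite A" using A V by (meson finite_SigmaI finite_subset)
  have "AE z in cube V. \<forall>e\<in>A. W (z (fst e)) (z (snd e)) = W' (z (fst e)) (z (snd e))"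
  proof (subst AE_finite_all[OF finA], intro ballI)
    fix e assume e: "e \<in> A"
    note ends = arc_ends[OF e A]
    from AE_cube_coordinates[OF V ends eq]
    show "AE z in cube V. W (z (fst e)) (z (snd e)) = W' (z (fst e)) (z (snd e))" by simp
  qed
  then show ?thesis
    by eventually_elim (auto simp: arc_product_def case_prod_unfold intro: prod.cong)
qed

text \<open>An automorphism permutes the coordinates of the cube, which preserves the product measure, and it
  permutes the factors of the arc product.\<close>

lemma nn_integral_arc_rooted_automorphism:
  fixes W :: "'a \<Rightarrow> 'a \<Rightarrow> real"
  assumes V: "finite V" "i \<in> V" "j \<in> V" "i \<noteq> j" and A: "A \<subseteq> V \<times> V"
    and W: "case_prod W \<in> borel_measurable (M \<Otimes>\<^sub>M M)"
    and \<phi>: "bij_betw \<phi> V V" and arcs: "\<And>u v. u \<in> V \<Longrightarrow> v \<in> V \<Longrightarrow> (\<phi> u, \<phi> v) \<in> A \<longleftrightarrow> (u, v) \<in> A"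
    and xy: "x \<in> space M" "y \<in> space M"
  shows "(\<integral>\<^sup>+z. ennreal (arc_product A W (z(i := x, j := y))) \<partial>cube (V - {i, j})) =
    (\<integral>\<^sup>+z. ennreal (arc_product A W (z(\<phi> i := x, \<phi> j := y))) \<partial>cube (V - {\<phi> i, \<phi> j}))"
proof -
  let ?V = "V - {i, j}" let ?V' = "V - {\<phi> i, \<phi> j}"
  have inj: "inj_on \<phi> V" and im: "\<phi> ` V = V" using \<phi> by (auto simp: bij_betw_def)
  have maps: "\<phi> \<in> ?V \<rightarrow> ?V'"
    using inj im V by (auto dest: inj_onD)
  have inj': "inj_on \<phi> ?V" using inj by (rule inj_on_subset) auto
  have distr: "distr (cube ?V') (cube ?V) (\<lambda>z. \<lambda>n\<in>?V. z (\<phi> n)) = cube ?V"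
    using distr_PiM_reindex[of ?V' "\<lambda>_. M", OF prob_space_axioms inj' maps] by simp
  have upd: "(\<lambda>z. z(i := x, j := y)) \<in> measurable (cube ?V) (cube V)"
    using measurable_set_two_coordinates_at[OF V(2,3), of "(x, y)"] xy by (simp add: space_pair_measure)
  have m: "(\<lambda>z. ennreal (arc_product A W (z(i := x, j := y)))) \<in> borel_measurable (cube ?V)"
    using measurable_compose[OF upd measurable_arc_product[OF W A]] by simp
  have tm: "(\<lambda>z. \<lambda>n\<in>?V. z (\<phi> n)) \<in> measurable (cube ?V') (cube ?V)"
    by (rule measurable_restrict, rule measurable_component_singleton) (use maps in auto)
  have bijA: "bij_betw (map_prod \<phi> \<phi>) A A"
  proof (rule bij_betw_imageI)
    show "inj_on (map_prod \<phi> \<phi>) A" using map_prod_inj_on[OF inj inj] A by (rule inj_on_subset)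
    show "map_prod \<phi> \<phi> ` A = A"
    proof (intro equalityI subsetI)
      fix e assume "e \<in> map_prod \<phi> \<phi> ` A" then show "e \<in> A" using A arcs by auto
    next
      fix e assume e: "e \<in> A"
      then have "fst e \<in> \<phi> ` V" "snd e \<in> \<phi> ` V" using A im by auto
      then obtain u v where uv: "u \<in> V" "v \<in> V" "e = (\<phi> u, \<phi> v)" by (metis imageE prod.collapse)
      then have "(u, v) \<in> A" using e arcs by auto
      then show "e \<in> map_prod \<phi> \<phi> ` A" using uv by force
    qed
  qed
  have eq: "arc_product A W ((\<lambda>n\<in>?V. z (\<phi> n))(i := x, j := y)) = arc_product A W (z(\<phi> i := x, \<phi> j := y))" for z
  proof -
    have pt: "((\<lambda>n\<in>?V. z (\<phi> n))(i := x, j := y)) u = (z(\<phi> i := x, \<phi> j := y)) (\<phi> u)" if "u \<in> V" for u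
      using that V inj by (auto dest: inj_onD)
    show ?thesis
      unfolding arc_product_def
      by (subst prod.reindex_bij_betw[OF bijA, symmetric], intro prod.cong refl)
        (use A pt in \<open>auto simp del: fun_upd_apply\<close>)
  qed
  have "(\<integral>\<^sup>+z. ennreal (arc_product A W (z(i := x, j := y))) \<partial>cube ?V) =
      (\<integral>\<^sup>+z. ennreal (arc_product A W ((\<lambda>n\<in>?V. z (\<phi> n))(i := x, j := y))) \<partial>cube ?V')"
    by (subst distr[symmetric], subst nn_integral_distr[OF tm]) (use m distr in simp_all)
  then show ?thesis by (simp only: eq)
qed

end

section \<open>From Lebesgue measurable to Borel measurable tournamentons\<close>

lemma borel_measurable_completion_if_AE_eq:
  assumes g: "g \<in> borel_measurable M" and eq: "AE x in M. f x = g x"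
  shows "f \<in> borel_measurable (completion M)"
proof (rule measurableI)
  fix S :: "'b set" assume S: "S \<in> sets borel"
  let ?N = "{x \<in> space M. f x \<noteq> g x}"
  have 1: "{x \<in> space M. \<not> f x = g x} \<in> sets (completion M)" 
    using sets_completion_AE[of "\<lambda>x. f x \<noteq> g x" M] eq by (simp add: pred_def)
  have 2: "{x \<in> space M. f x \<noteq> g x \<and> f x \<in> S} \<in> sets (completion M)"
  proof -
    have "AE x in M. \<not> (f x \<noteq> g x \<and> f x \<in> S)" using eq by eventually_elim simp
    from sets_completion_AE[OF this] show ?thesis by (simp add: pred_def)
  qed
  have "g -` S \<inter> space M \<in> sets (completion M)"
    using measurable_sets[OF g S] by auto
  moreover have "f -` S \<inter> space (completion M) =
      (g -` S \<inter> space M) - ?N \<union> {x \<in> space M. f x \<noteq> g x \<and> f x \<in> S}" by auto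
  ultimately show "f -` S \<inter> space (completion M) \<in> sets (completion M)" using 1 2 by auto
qed auto

lemma integral_completion_AE_eq:
  fixes f g :: "'a \<Rightarrow> real"
  assumes g: "g \<in> borel_measurable M" and eq: "AE x in M. f x = g x"
  shows "(\<integral>x. f x \<partial>completion M) = (\<integral>x. g x \<partial>M)"
proof -
  have "(\<integral>x. f x \<partial>completion M) = (\<integral>x. g x \<partial>completion M)"
    using borel_measurable_completion_if_AE_eq[OF assms] g eq
    by (intro integral_cong_AE) (auto intro: AE_completion measurable_completion)
  then show ?thesis using integral_completion[OF g] by simp
qed

abbreviation unit_interval :: "real measure" where
  "unit_interval \<equiv> restrict_space lborel {0..1}"

interpretation unit_interval: prob_space unit_interval
  by (rule prob_spaceI) (simp add: emeasure_restrict_space space_restrict_space)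

text \<open>The cube is built from the Borel measure on the interval, the unit square from the Lebesgue measure
  on the plane. The two have the same null sets of pairs, which is what this identity and the next
  lemma provide.\<close>

lemma pair_unit_interval:
  "unit_interval \<Otimes>\<^sub>M unit_interval = restrict_space (lborel :: (real \<times> real) measure) ({0..1} \<times> {0..1})"
proof (rule pair_measure_eqI)
  let ?I = "{0..1::real}" and ?R = "restrict_space (lborel :: (real \<times> real) measure) ({0..1} \<times> {0..1})"
  have S: "?I \<times> ?I \<in> sets (borel :: (real \<times> real) measure)" by (intro borel_closed closed_Times) auto
  show "sigma_finite_measure unit_interval" by (rule unit_interval.sigma_finite_measure_axioms)
  then show "sigma_finite_measure unit_interval" .
  have sp: "space (unit_interval \<Otimes>\<^sub>M unit_interval) = ?I \<times> ?I" "space ?R = ?I \<times> ?I"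
    using S by (auto simp: space_pair_measure space_restrict_space)
  have id1: "(\<lambda>p. p) \<in> measurable ?R (unit_interval \<Otimes>\<^sub>M unit_interval)"
  proof -
    have "fst \<in> borel_measurable (borel :: (real \<times> real) measure)"
      "snd \<in> borel_measurable (borel :: (real \<times> real) measure)"
      by (intro borel_measurable_continuous_onI continuous_intros)+
    then have "fst \<in> measurable ?R unit_interval" "snd \<in> measurable ?R unit_interval"
      by (intro measurable_restrict_space2 measurable_restrict_space1; force simp: sp)+
    then have "(\<lambda>p. (fst p, snd p)) \<in> measurable ?R (unit_interval \<Otimes>\<^sub>M unit_interval)"
      by (rule measurable_Pair)
    then show ?thesis by simp
  qed
  have 1: "sets (unit_interval \<Otimes>\<^sub>M unit_interval) \<subseteq> sets ?R"
  proof
    fix X assume X: "X \<in> sets (unit_interval \<Otimes>\<^sub>M unit_interval)"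
    from measurable_sets[OF id1 X] sets.sets_into_space[OF X] show "X \<in> sets ?R"
      unfolding sp vimage_ident by (simp only: Int_absorb2)
  qed
  have id2: "(\<lambda>p. p) \<in> measurable (unit_interval \<Otimes>\<^sub>M unit_interval) ?R"
  proof (rule measurable_restrict_space2)
    have "fst \<in> measurable (unit_interval \<Otimes>\<^sub>M unit_interval) borel"
      "snd \<in> measurable (unit_interval \<Otimes>\<^sub>M unit_interval) borel"
      by (auto intro!: measurable_compose[OF measurable_fst] measurable_compose[OF measurable_snd]
        measurable_restrict_space1)
    then have "(\<lambda>p. (fst p, snd p)) \<in> borel_measurable (unit_interval \<Otimes>\<^sub>M unit_interval)"
      by (rule borel_measurable_Pair)
    then show "(\<lambda>p. p) \<in> measurable (unit_interval \<Otimes>\<^sub>M unit_interval) (lborel :: (real \<times> real) measure)"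
      by simp
  qed (auto simp: sp)
  have 2: "sets ?R \<subseteq> sets (unit_interval \<Otimes>\<^sub>M unit_interval)"
  proof
    fix X assume X: "X \<in> sets ?R"
    from measurable_sets[OF id2 X] sets.sets_into_space[OF X] show "X \<in> sets (unit_interval \<Otimes>\<^sub>M unit_interval)"
      unfolding sp vimage_ident by (simp only: Int_absorb2)
  qed
  from 1 2 show "sets (unit_interval \<Otimes>\<^sub>M unit_interval) = sets ?R" by simp
  fix A B assume AB: "A \<in> sets unit_interval" "B \<in> sets unit_interval"
  then have "A \<subseteq> ?I" "B \<subseteq> ?I" "A \<in> sets borel" "B \<in> sets borel"
    by (auto simp: sets_restrict_space_iff)
  then show "emeasure unit_interval A * emeasure unit_interval B = emeasure ?R (A \<times> B)"
    using S by (subst (3) emeasure_restrict_space)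
      (auto simp: emeasure_restrict_space lborel_prod[symmetric] lborel.emeasure_pair_measure_Times)
qed

lemma AE_unit_square_iff:
  "(AE p in unit_square. P p) \<longleftrightarrow> (AE p in unit_interval \<Otimes>\<^sub>M unit_interval. P p)"
proof -
  have S: "{0..1::real} \<times> {0..1::real} \<in> sets borel" by (intro borel_closed closed_Times) auto
  show ?thesis
    unfolding pair_unit_interval using S
    by (simp add: AE_restrict_space_iff AE_completion_iff)
qed

text \<open>A Borel measurable kernel can be composed with coordinate maps without completing the product
  measure. Truncation to the unit interval makes the bounds hold everywhere, also outside the
  square.\<close>

lemma tournamenton_Borel_version:
  assumes "tournamenton W"
  obtains W' where "case_prod W' \<in> borel_measurable (unit_interval \<Otimes>\<^sub>M unit_interval)"
    "\<And>x y. 0 \<le> W' x y" "\<And>x y. W' x y \<le> (1::real)"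
    "AE p in unit_interval \<Otimes>\<^sub>M unit_interval. W (fst p) (snd p) = W' (fst p) (snd p)"
    "AE p in unit_interval \<Otimes>\<^sub>M unit_interval. W' (fst p) (snd p) + W' (snd p) (fst p) = 1"
proof -
  let ?S = "{0..1::real} \<times> {0..1::real}"
  have S: "?S \<in> sets borel" by (intro borel_closed closed_Times) auto
  have W: "(\<lambda>(x, y). W x y) \<in> borel_measurable unit_square"
    and W01: "\<And>x y. x \<in> {0..1} \<Longrightarrow> y \<in> {0..1} \<Longrightarrow> 0 \<le> W x y \<and> W x y \<le> 1"
    and skew: "AE p in unit_interval \<Otimes>\<^sub>M unit_interval. W (fst p) (snd p) + W (snd p) (fst p) = 1"
    using assms unfolding tournamenton_def AE_unit_square_iff by (auto simp: case_prod_unfold)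
  have "(\<lambda>p. if p \<in> ?S then (\<lambda>(x, y). W x y) p else 0) \<in> borel_measurable lebesgue"
    using W by (rule measurable_restrict_space_iff[THEN iffD1, rotated 2]) (use S in simp_all)
  from completion_ex_borel_measurable_real[OF this] obtain g where g: "g \<in> borel_measurable lborel"
    and ae: "AE p in lborel. (if p \<in> ?S then (\<lambda>(x, y). W x y) p else 0) = g p" by blast
  define W' where "W' x y = max 0 (min 1 (g (x, y)))" for x y
  have eq: "AE p in unit_interval \<Otimes>\<^sub>M unit_interval. W (fst p) (snd p) = W' (fst p) (snd p)"
    unfolding pair_unit_interval
  proof (subst AE_restrict_space_iff)
    show "?S \<inter> space lborel \<in> sets lborel" using S by simp
    show "AE p in lborel. p \<in> ?S \<longrightarrow> W (fst p) (snd p) = W' (fst p) (snd p)"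
      using ae
    proof eventually_elim
      case (elim p)
      show ?case
      proof
        assume p: "p \<in> ?S"
        then have "g p = W (fst p) (snd p)" using elim by (simp add: case_prod_unfold)
        moreover have "0 \<le> W (fst p) (snd p)" "W (fst p) (snd p) \<le> 1"
          using W01[of "fst p" "snd p"] p by (auto simp: mem_Times_iff)
        ultimately show "W (fst p) (snd p) = W' (fst p) (snd p)" by (simp add: W'_def)
      qed
    qed
  qed
  show thesis
  proof (rule that)
    have [measurable]: "g \<in> borel_measurable (unit_interval \<Otimes>\<^sub>M unit_interval)"
      unfolding pair_unit_interval by (rule measurable_restrict_space1[OF g])
    show "case_prod W' \<in> borel_measurable (unit_interval \<Otimes>\<^sub>M unit_interval)"
      unfolding W'_def case_prod_unfold by simp
    show "0 \<le> W' x y" "W' x y \<le> 1" for x y by (auto simp: W'_def)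
    show "AE p in unit_interval \<Otimes>\<^sub>M unit_interval. W (fst p) (snd p) = W' (fst p) (snd p)" by (fact eq)
    show "AE p in unit_interval \<Otimes>\<^sub>M unit_interval. W' (fst p) (snd p) + W' (snd p) (fst p) = 1"
      using eq unit_interval.AE_pair_swap[of "\<lambda>x y. W x y = W' x y", OF eq] skew
      by eventually_elim simp
  qed
qed

section \<open>Tournaments with constant arc-rooted densities\<close>

theorem theorem1p4:
  fixes T :: "'a pair_pre_digraph" and W :: "real \<Rightarrow> real \<Rightarrow> real"
  assumes "tournament T"
    and "parcs T \<noteq> {}"
    and "tournamenton W"
  shows "((\<forall>a \<in> parcs T. ae_constant (arc_rooted_density T W a)) \<longrightarrow>
           tournament_density T W = 0 \<or> (AE (x, y) in unit_square. W x y = 1 / 2)) \<and>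
         (arc_transitive (with_proj T) \<and> (\<exists>a \<in> parcs T. ae_constant (arc_rooted_density T W a)) \<longrightarrow>
           tournament_density T W = 0 \<or> (AE (x, y) in unit_square. W x y = 1 / 2))"
proof -
  interpret tournament T by fact
  let ?V = "pverts T" and ?A = "parcs T"
  have V: "finite ?V" by simp
  have A: "?A \<subseteq> ?V \<times> ?V" using arc_fst_in_verts arc_snd_in_verts by fastforce
  have loop: "(v, v) \<notin> ?A" for v using no_loops by fastforce
  have asym: "(j, i) \<notin> ?A" if "(i, j) \<in> ?A" for i j
    using exactly_one_arc[of i j] that A loop by blast
  obtain W' where W': "case_prod W' \<in> borel_measurable (unit_interval \<Otimes>\<^sub>M unit_interval)"
    and W'0: "\<And>x y. 0 \<le> W' x y" and W'1: "\<And>x y. W' x y \<le> 1"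
    and eq: "AE p in unit_interval \<Otimes>\<^sub>M unit_interval. W (fst p) (snd p) = W' (fst p) (snd p)"
    and skew: "AE p in unit_interval \<Otimes>\<^sub>M unit_interval. W' (fst p) (snd p) + W' (snd p) (fst p) = 1"
    using tournamenton_Borel_version[OF assms(3)] by blast
  interpret C: prob_space "unit_interval.cube B" for B :: "'a set" by (rule unit_interval.prob_space_cube)
  define F where "F = arc_product ?A W'"
  have F01: "0 \<le> F z" "F z \<le> 1" for z
    unfolding F_def arc_product_def by (auto intro!: prod_nonneg prod_le_1 W'0 W'1)
  have Fm: "F \<in> borel_measurable (unit_interval.cube ?V)"
    unfolding F_def by (rule unit_interval.measurable_arc_product[OF W' A])
  have Feq: "AE z in unit_interval.cube ?V. arc_product ?A W z = F z"
    unfolding F_def by (rule unit_interval.AE_arc_product_cong[OF V A loop eq])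
  define t where "t = tournament_density T W"
  have "t = (\<integral>z. F z \<partial>unit_interval.cube ?V)"
    using integral_completion_AE_eq[OF Fm Feq]
    by (simp add: t_def tournament_density_def unit_cube_def arc_product_def)
  then have t0: "0 \<le> t" and intF: "(\<integral>\<^sup>+z. ennreal (F z) \<partial>unit_interval.cube ?V) = ennreal t"
    using F01 by (auto intro!: integral_nonneg nn_integral_eq_integral C.integrable_const_bound[where B=1] simp: Fm)
  \<comment> \<open>The densities are defined with \<open>W\<close> and completed measures; for almost every root they are
    integrals of the Borel measurable \<open>F\<close>.\<close>
  have rooted: "AE p in unit_interval \<Otimes>\<^sub>M unit_interval. ennreal (arc_rooted_density T W (i, j) (fst p) (snd p)) =
      (\<integral>\<^sup>+z. ennreal (F (z(i := fst p, j := snd p))) \<partial>unit_interval.cube (?V - {i, j}))"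
    if ij: "(i, j) \<in> ?A" for i j
  proof -
    have ij': "i \<in> ?V" "j \<in> ?V" "i \<noteq> j" using ij A loop by auto
    have "AE p in unit_interval \<Otimes>\<^sub>M unit_interval. p \<in> space (unit_interval \<Otimes>\<^sub>M unit_interval)" by simp
    with unit_interval.AE_cube_split[OF V ij' Feq] show ?thesis
    proof eventually_elim
      case (elim p)
      have m: "(\<lambda>z. F (z(i := fst p, j := snd p))) \<in> borel_measurable (unit_interval.cube (?V - {i, j}))"
        by (rule measurable_compose[OF
          unit_interval.measurable_set_two_coordinates_at[OF ij'(1,2) elim(2)] Fm])
      have "arc_rooted_density T W (i, j) (fst p) (snd p) =
          (\<integral>z. F (z(i := fst p, j := snd p)) \<partial>unit_interval.cube (?V - {i, j}))"
        using integral_completion_AE_eq[OF m elim(1)]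
        by (simp add: arc_rooted_density_def unit_cube_def arc_product_def)
      then show ?case
        using F01 by (simp add: nn_integral_eq_integral C.integrable_const_bound[where B=1] m)
    qed
  qed
  \<comment> \<open>The constant can only be \<open>t\<close>, as every arc-rooted density has integral \<open>t\<close>. Stating the
    condition with this value makes it the same for all arcs.\<close>
  define uniform where "uniform a \<longleftrightarrow> (AE p in unit_interval \<Otimes>\<^sub>M unit_interval.
    (\<integral>\<^sup>+z. ennreal (F (z(fst a := fst p, snd a := snd p))) \<partial>unit_interval.cube (?V - {fst a, snd a})) = ennreal t)"
    for a
  have uniform: "uniform a" if a: "a \<in> ?A" "ae_constant (arc_rooted_density T W a)" for a
  proof -
    obtain i j where aij: "a = (i, j)" by fastforce
    have ij: "(i, j) \<in> ?A" "i \<in> ?V" "j \<in> ?V" "i \<noteq> j" using a aij A loop by auto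
    obtain c where "AE p in unit_interval \<Otimes>\<^sub>M unit_interval. arc_rooted_density T W (i, j) (fst p) (snd p) = c"
      using a(2) unfolding ae_constant_def AE_unit_square_iff aij by (auto simp: case_prod_unfold)
    with rooted[OF ij(1)] have c: "AE p in unit_interval \<Otimes>\<^sub>M unit_interval.
        (\<integral>\<^sup>+z. ennreal (F (z(i := fst p, j := snd p))) \<partial>unit_interval.cube (?V - {i, j})) = ennreal c"
      by eventually_elim simp
    have "ennreal t = ennreal c"
      using unit_interval.nn_integral_uniform_marginal[OF V ij(2-4), of "\<lambda>z. ennreal (F z)" "\<lambda>_ _. 1"] c Fm intF
      by (simp add: C.emeasure_space_1)
    with c show ?thesis by (simp add: uniform_def aij)
  qed
  have all_uniform: "t = 0 \<or> (AE (x, y) in unit_square. W x y = 1 / 2)" if unif: "\<And>a. a \<in> ?A \<Longrightarrow> uniform a"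
  proof (cases "t = 0")
    case False
    with t0 have t: "t > 0" by simp
    have const: "AE z in unit_interval.cube ?V. arc_product ?A W' z = t"
      by (rule unit_interval.arc_product_AE_constant[OF V A loop assms(2) W' W'0 W'1 t])
        (use unif[unfolded uniform_def F_def] in fastforce)
    obtain i j where ij: "(i, j) \<in> ?A" using assms(2) by auto
    obtain a b where "AE p in unit_interval \<Otimes>\<^sub>M unit_interval. a (fst p) > 0 \<and> b (snd p) > 0 \<and>
        W' (fst p) (snd p) = a (fst p) * b (snd p)"
      by (rule unit_interval.AE_rank_one_factorization[OF V A ij asym[OF ij] _ W' W'0 t const])
        (use ij loop in auto)
    from unit_interval.AE_half_if_rank_one[OF this skew] eq
    have "AE p in unit_interval \<Otimes>\<^sub>M unit_interval. W (fst p) (snd p) = 1 / 2" by eventually_elim simp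
    then show ?thesis by (simp add: AE_unit_square_iff case_prod_unfold)
  qed simp
  have transitive: "uniform b" if tr: "arc_transitive (with_proj T)" and a: "a \<in> ?A" "uniform a" and b: "b \<in> ?A" for a b
  proof -
    obtain \<phi> where bij: "bij_betw \<phi> ?V ?V"
      and arcs: "\<And>u v. u \<in> ?V \<Longrightarrow> v \<in> ?V \<Longrightarrow> (\<phi> u, \<phi> v) \<in> ?A \<longleftrightarrow> (u, v) \<in> ?A"
      and ab: "(\<phi> (fst a), \<phi> (snd a)) = b"
      using tr[unfolded arc_transitive_iff_vertex_maps, rule_format, OF a(1) b] by blast
    note a' = arc_ends[OF a(1) A loop]
    have "AE p in unit_interval \<Otimes>\<^sub>M unit_interval. p \<in> space (unit_interval \<Otimes>\<^sub>M unit_interval)" by simp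
    with a(2) show ?thesis
      unfolding uniform_def
    proof eventually_elim
      case (elim p)
      then have "fst p \<in> space unit_interval" "snd p \<in> space unit_interval" by (auto simp: space_pair_measure)
      from unit_interval.nn_integral_arc_rooted_automorphism[OF V a' A W' bij arcs this] elim(1) ab
      show ?case by (auto simp: F_def)
    qed
  qed
  show ?thesis
  proof (intro conjI impI)
    assume "\<forall>a \<in> ?A. ae_constant (arc_rooted_density T W a)"
    then show "tournament_density T W = 0 \<or> (AE (x, y) in unit_square. W x y = 1 / 2)"
      using uniform all_uniform by (simp add: t_def)
  next
    assume "arc_transitive (with_proj T) \<and> (\<exists>a \<in> ?A. ae_constant (arc_rooted_density T W a))"
    then obtain a where tr: "arc_transitive (with_proj T)" and a: "a \<in> ?A" "uniform a"
      using uniform by blast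
    show "tournament_density T W = 0 \<or> (AE (x, y) in unit_square. W x y = 1 / 2)"
      using all_uniform[OF transitive[OF tr a]] by (simp add: t_def)
  qed
qed

end
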